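(* Let $p>1$ be an integer and let $u^{(p)}$ be the fixed point of the substitution $\varphi_p(L)=L^pS$, $\varphi_p(S)=M$, $\varphi_p(M)=L^{p-1}S$. Let $v,w$ be factors of $u^{(p)}$ with $|v|=|w|$. Then $\left||v|_S-|w|_S\right|\le 2$.
   Context: $u^{(p)}=\lim_{n\to\infty}\varphi_p^n(L)$ is the unique infinite word over $\{L,S,M\}$ fixed by $\varphi_p$. A factor is a finite contiguous subword; $|w|$ is the length and $|w|_a$ the number of occurrences of the letter $a$ in $w$. *)

theory Defs
  imports Main
begin

datatype letter = L | S | M

fun phi :: "nat \<Rightarrow> letter \<Rightarrow> letter list" where
  "phi p L = replicate p L @ [S]"
| "phi p S = [M]"
| "phi p M = replicate (p - 1) L @ [S]"

definition phi_word :: "nat \<Rightarrow> letter list \<Rightarrow> letter list" where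
  "phi_word p w = concat (map (phi p) w)"

definition u :: "nat \<Rightarrow> nat \<Rightarrow> letter" where
  "u p n = (SOME a. \<exists>K. \<forall>k\<ge>K. n < length ((phi_word p ^^ k) [L])
                              \<and> (phi_word p ^^ k) [L] ! n = a)"

definition factor :: "letter list \<Rightarrow> (nat \<Rightarrow> letter) \<Rightarrow> bool" where
  "factor v x = (\<exists>i. v = map x [i..<i + length v])"

end

theory Submission
  imports Defs Complex_Main
begin

text \<open>
  Let \<open>b\<close> be the dominant root of \<open>x\<^sup>3 - p x\<^sup>2 - x + 1\<close>, the characteristic polynomial of the
  substitution.  The letter \<open>S\<close> has frequency \<open>r = 1 / (b + 1)\<close>, so it suffices that the
  discrepancy \<open>D w = |w|_S - r |w|\<close> of the prefixes \<open>w\<close> of the fixed point stays in an interval of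
  length less than \<open>3/2\<close>.  Put \<open>e = b - p\<close> and \<open>F w = D (\<phi> w) + e D w\<close>.  Every prefix has the form
  \<open>\<phi>(w') L^d\<close> with \<open>w'\<close> a shorter prefix, and then \<open>F w = D w' / b\<close> and
  \<open>D w = F w' - e D w' - r d\<close>.  The admissible \<open>d\<close> depend only on the letter following \<open>w'\<close>, so
  one can propagate bounds on \<open>(D, F)\<close>, one set of bounds for each letter following the prefix.
\<close>

section \<open>Prefixes of the fixed point\<close>

lemma phi_word_Nil [simp]: "phi_word p [] = []"
  and phi_word_Cons [simp]: "phi_word p (x # w) = phi p x @ phi_word p w"
  and phi_word_append [simp]: "phi_word p (v @ w) = phi_word p v @ phi_word p w"
  by (simp_all add: phi_word_def)

lemma phi_word_funpow_append:
  "(phi_word p ^^ k) (v @ w) = (phi_word p ^^ k) v @ (phi_word p ^^ k) w"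
  by (induction k arbitrary: v w) simp_all

lemma length_phi_word_ge: "length w \<le> length (phi_word p w)"
proof (induction w)
  case (Cons x w)
  have "1 \<le> length (phi p x)" by (cases x) simp_all
  then show ?case using Cons by simp
qed simp

lemma length_phi_word_funpow_ge: "length w \<le> length ((phi_word p ^^ k) w)"
  by (induction k) (use length_phi_word_ge le_trans in \<open>auto, blast\<close>)

text \<open>For \<open>p > 0\<close> the word \<open>phi p L\<close> begins with \<open>L\<close>;
  applying the \<open>k\<close>-th iterate to its remaining letters gives the nonempty
  extension.\<close>

lemma phi_word_funpow_Suc_prefix:
  assumes "p > 0"
  obtains w where "w \<noteq> []" "(phi_word p ^^ Suc k) [L] = (phi_word p ^^ k) [L] @ w"
proof -
  obtain q where q: "p = Suc q" using assms by (cases p) auto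
  have "(phi_word p ^^ Suc k) [L] = (phi_word p ^^ k) ([L] @ (replicate q L @ [S]))"
    by (simp add: funpow_Suc_right q del: funpow.simps)
  also have "\<dots> = (phi_word p ^^ k) [L] @ (phi_word p ^^ k) (replicate q L @ [S])"
    by (rule phi_word_funpow_append)
  finally show ?thesis
    using that[of "(phi_word p ^^ k) (replicate q L @ [S])"]
      length_phi_word_funpow_ge[of "replicate q L @ [S]" k p] by fastforce
qed

lemma phi_word_funpow_prefix:
  assumes "p > 0" "k \<le> l"
  obtains w where "(phi_word p ^^ l) [L] = (phi_word p ^^ k) [L] @ w"
proof -
  have "\<exists>w. (phi_word p ^^ l) [L] = (phi_word p ^^ k) [L] @ w"
    using assms(2)
  proof (induction l rule: dec_induct)
    case (step l)
    then show ?case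
      using phi_word_funpow_Suc_prefix[OF assms(1), of l] by (metis append.assoc)
  qed simp
  then show ?thesis using that by blast
qed

lemma length_phi_word_funpow_gt: "p > 0 \<Longrightarrow> k < length ((phi_word p ^^ k) [L])"
proof (induction k)
  case (Suc k)
  obtain w where "w \<noteq> []" "(phi_word p ^^ Suc k) [L] = (phi_word p ^^ k) [L] @ w"
    using phi_word_funpow_Suc_prefix[OF Suc.prems] .
  then show ?case using Suc by (cases w) (auto simp del: funpow.simps)
qed simp

lemma u_eq_nth:
  assumes "p > 0" "n < length ((phi_word p ^^ k) [L])"
  shows "u p n = (phi_word p ^^ k) [L] ! n"
proof -
  have ext: "n < length ((phi_word p ^^ l) [L]) \<and>
      (phi_word p ^^ l) [L] ! n = (phi_word p ^^ k) [L] ! n" if "l \<ge> k" for l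
  proof -
    obtain w where "(phi_word p ^^ l) [L] = (phi_word p ^^ k) [L] @ w"
      using phi_word_funpow_prefix[OF assms(1) \<open>l \<ge> k\<close>] .
    then show ?thesis using assms(2) by (simp add: nth_append)
  qed
  show ?thesis
    unfolding u_def
  proof (rule some_equality)
    fix a
    assume "\<exists>K. \<forall>l\<ge>K. n < length ((phi_word p ^^ l) [L]) \<and> (phi_word p ^^ l) [L] ! n = a"
    then obtain K where
      "\<forall>l\<ge>K. n < length ((phi_word p ^^ l) [L]) \<and> (phi_word p ^^ l) [L] ! n = a" by blast
    then show "a = (phi_word p ^^ k) [L] ! n"
      using ext[of "max k K"] by auto
  qed (use ext in blast)
qed

text \<open>Desubstitution: the marked \<open>x\<close> lies in the image block of one letter
  \<open>y\<close>, and \<open>t\<close> is the part of that block before it.\<close>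

lemma phi_word_split:
  assumes "phi_word p v = w @ x # r"
  obtains v1 y v2 t s where "v = v1 @ y # v2" "phi p y = t @ x # s" "w = phi_word p v1 @ t"
proof -
  have "\<exists>v1 y v2 t s. v = v1 @ y # v2 \<and> phi p y = t @ x # s \<and> w = phi_word p v1 @ t"
    using assms
  proof (induction v arbitrary: w)
    case (Cons z v)
    then have "phi p z @ phi_word p v = w @ x # r" by simp
    then consider us where "phi p z = w @ us" "us @ phi_word p v = x # r"
      | us where "w = phi p z @ us" "phi_word p v = us @ x # r"
      by (auto simp: append_eq_append_conv2)
    then show ?case
    proof cases
      case 1
      show ?thesis
      \<comment> \<open>If \<open>us\<close> is empty, \<open>w\<close> ends exactly at a block
        boundary, so \<open>x\<close> belongs to a later block.\<close>
      proof (cases us)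
        case Nil
        then obtain v1 y v2 t s where
          "v = v1 @ y # v2" "phi p y = t @ x # s" "[] = phi_word p v1 @ t"
          using Cons.IH[of "[]"] 1 by auto
        then have "z # v = (z # v1) @ y # v2" "w = phi_word p (z # v1) @ t"
          using 1 Nil by auto
        then show ?thesis using \<open>phi p y = t @ x # s\<close> by blast
      next
        case (Cons a us')
        then have "z # v = [] @ z # v" "phi p z = w @ x # us'" "w = phi_word p [] @ w"
          using 1 by auto
        then show ?thesis by blast
      qed
    next
      case 2
      then obtain v1 y v2 t s where
        "v = v1 @ y # v2" "phi p y = t @ x # s" "us = phi_word p v1 @ t"
        using Cons.IH by blast
      then have "z # v = (z # v1) @ y # v2" "w = phi_word p (z # v1) @ t"
        using 2 by auto
      then show ?thesis using \<open>phi p y = t @ x # s\<close> by blast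
    qed
  qed simp
  then show ?thesis using that by blast
qed

text \<open>Carrying the next letter along with the prefix lets an invariant depend on it, since
  that letter decides which \<open>t\<close> can follow.\<close>

lemma u_prefix_induct:
  assumes "p > 0"
    and base: "P [] L"
    and step: "\<And>v y t x s. P v y \<Longrightarrow> phi p y = t @ x # s \<Longrightarrow> P (phi_word p v @ t) x"
  shows "P (map (u p) [0..<n]) (u p n)"
proof -
  have *: "P w x" if "(phi_word p ^^ k) [L] = w @ x # r" for k w x r
    using that
  proof (induction k arbitrary: w x r)
    case 0
    then show ?case using base by (simp add: Cons_eq_append_conv)
  next
    case (Suc k)
    then have "phi_word p ((phi_word p ^^ k) [L]) = w @ x # r" by simp
    then obtain v1 y v2 t s where "(phi_word p ^^ k) [L] = v1 @ y # v2"
      "phi p y = t @ x # s" "w = phi_word p v1 @ t"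
      by (rule phi_word_split)
    then show ?case using Suc.IH step by blast
  qed
  let ?W = "(phi_word p ^^ n) [L]"
  have n: "n < length ?W" using length_phi_word_funpow_gt assms(1) by blast
  have "map (u p) [0..<n] = take n ?W"
    using n by (intro nth_equalityI) (auto simp: u_eq_nth[OF assms(1), where k = n])
  moreover have "?W = take n ?W @ ?W ! n # drop (Suc n) ?W"
    using n by (rule id_take_nth_drop)
  ultimately show ?thesis
    using * u_eq_nth[OF assms(1) n] by metis
qed

lemma phi_split_cases:
  assumes "phi p y = t @ x # s"
  obtains d where "y = L" "x = L" "t = replicate d L" "d + 1 \<le> p"
  | "y = L" "x = S" "t = replicate p L"
  | "y = S" "x = M" "t = []"
  | d where "y = M" "x = L" "t = replicate d L" "d + 1 \<le> p - 1"
  | "y = M" "x = S" "t = replicate (p - 1) L"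
proof -
  have *: "(\<exists>d. x = L \<and> t = replicate d L \<and> d + 1 \<le> q) \<or> x = S \<and> t = replicate q L"
    if "replicate q L @ [S] = t @ x # s" for q
    using that
  proof (induction q arbitrary: t)
    case 0
    then show ?case by (cases t) auto
  next
    case (Suc q)
    show ?case
    proof (cases t)
      case Nil
      then have "x = L" "t = replicate 0 L" using Suc.prems by auto
      then show ?thesis by fastforce
    next
      case (Cons a t')
      then have a: "a = L" "replicate q L @ [S] = t' @ x # s" using Suc.prems by auto
      from Suc.IH[OF a(2)] show ?thesis
      proof (elim disjE exE conjE)
        fix d assume "x = L" "t' = replicate d L" "d + 1 \<le> q"
        then have "x = L \<and> t = replicate (Suc d) L \<and> Suc d + 1 \<le> Suc q" using Cons a by simp
        then show ?thesis by blast
      qed (use Cons a in simp)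
    qed
  qed
  show ?thesis
  proof (cases y)
    case L
    then show ?thesis using *[of p] assms that(1,2) by auto
  next
    case S
    then show ?thesis using assms that(3) by (auto simp: Cons_eq_append_conv)
  next
    case M
    then show ?thesis using *[of "p - 1"] assms that(4,5) by auto
  qed
qed

section \<open>The discrepancy of a prefix\<close>

text \<open>The value 56/25 lies just below the largest root for \<open>p = 2\<close>, about
  2.247.\<close>

locale dominant_root =
  fixes p :: nat and b :: real
  assumes p_gt_1: "p > 1"
    and b_ge: "56 / 25 \<le> b"
    and root: "b\<^sup>2 * (b - p) = b - 1"
begin

definition e :: real where "e = b - p"
definition r :: real where "r = 1 / (b + 1)"

definition D :: "letter list \<Rightarrow> real" where
  "D w = count_list w S - r * length w"

definition F :: "letter list \<Rightarrow> real" where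
  "F w = D (phi_word p w) + e * D w"

lemma b_pos: "b > 0" and r_pos: "r > 0" and e_eq: "e = (b - 1) / b\<^sup>2" and e_pos: "e > 0"
proof -
  show *: "b > 0" "r > 0" using b_ge by (simp_all add: r_def)
  show e: "e = (b - 1) / b\<^sup>2" using root * by (simp add: e_def field_simps)
  then show "e > 0" using b_ge * by simp
qed

lemma r_mult: "r * (b + 1) = 1"
  using b_pos by (simp add: r_def)

lemma e_mult: "b * (b * e) = b - 1"
  using root by (simp add: e_def power2_eq_square mult.assoc)

lemma D_append: "D (v @ w) = D v + D w"
  by (simp add: D_def algebra_simps)

lemma D_Nil [simp]: "D [] = 0"
  by (simp add: D_def)

lemma D_replicate_L: "D (replicate d L) = - r * d"
  by (induction d) (simp_all add: D_def algebra_simps)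

lemma D_letter: "D [L] = - r" "D [S] = 1 - r" "D [M] = - r"
  by (simp_all add: D_def)

lemma D_phi: "D (phi p L) = r * e" "D (phi p S) = - r" "D (phi p M) = r * e + r"
proof -
  have 1: "1 - r - r * p = r * e" using r_mult by (simp add: e_def algebra_simps)
  then show "D (phi p L) = r * e"
    by (simp add: D_append D_replicate_L D_letter)
  show "D (phi p S) = - r" by (simp add: D_letter)
  show "D (phi p M) = r * e + r"
    using 1 p_gt_1 by (simp add: D_append D_replicate_L D_letter of_nat_diff algebra_simps)
qed

lemma F_append: "F (v @ w) = F v + F w"
  by (simp add: F_def D_append algebra_simps)

lemma F_Nil [simp]: "F [] = 0"
  by (simp add: F_def)

lemma F_letter: "F [L] = 0" "F [S] = e - r - e * r" "F [M] = r"
  by (simp_all only: F_def phi_word_Cons phi_word_Nil append_Nil2 D_phi D_letter)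
    (simp_all add: algebra_simps)

text \<open>This is why \<open>e\<close> is the right weight in \<open>F\<close>:
  \<open>D (phi p L) = r * e\<close> cancels \<open>e * D [L]\<close>, so trailing letters
  \<open>L\<close> do not affect \<open>F\<close>.\<close>

lemma F_replicate_L: "F (replicate d L) = 0"
proof (induction d)
  case (Suc d)
  then show ?case using F_append[of "[L]" "replicate d L"] F_letter by simp
qed simp

text \<open>The cubic factors as \<open>(x - b) * (x^2 + e * x - 1 / b)\<close>. Since
  \<open>D\<close> kills the frequency eigenvector for \<open>b\<close>, its iterates under the
  substitution obey the quadratic factor.\<close>

lemma F_phi: "F (phi p x) = D [x] / b"
proof -
  have S: "F [S] = - r / b"
  proof -
    have "b * (b + 1) * F [S] = b * e * (b + 1) - b * (r * (b + 1)) - b * e * (r * (b + 1))"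
      by (simp add: F_letter algebra_simps)
    also have "\<dots> = b * (b * e) - b" by (simp only: r_mult) (simp add: algebra_simps)
    also have "\<dots> = (b + 1) * b * (- r / b)"
      using e_mult r_mult b_pos by (simp add: algebra_simps)
    finally have "(b + 1) * b * F [S] = (b + 1) * b * (- r / b)" by (simp only: mult.commute[of b])
    then show ?thesis using b_pos by (subst (asm) mult_cancel_left) auto
  qed
  show ?thesis
  proof (cases x)
    case L
    then show ?thesis by (simp add: F_append F_replicate_L S D_letter)
  next
    case M
    then show ?thesis by (simp add: F_append F_replicate_L S D_letter)
  next
    case x: S
    have "r * b = 1 - r" using r_mult by (simp add: algebra_simps)
    then show ?thesis using b_pos x by (simp add: F_letter D_letter field_simps)
  qed
qed

lemma F_phi_word: "F (phi_word p w) = D w / b"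
proof (induction w)
  case (Cons x w)
  have "D (x # w) = D [x] + D w" using D_append[of "[x]" w] by simp
  then show ?case using Cons by (simp add: F_append F_phi add_divide_distrib)
qed simp

lemma F_step: "F (phi_word p w @ replicate d L) = D w / b"
  by (simp add: F_append F_phi_word F_replicate_L)

lemma D_step: "D (phi_word p w @ replicate d L) = F w - e * D w - r * d"
  by (simp add: D_append D_replicate_L F_def)

section \<open>Closing the system of bounds on \<open>D\<close> and \<open>F\<close>\<close>

text \<open>
  \<open>- A\<close> and \<open>A / b\<close> are the global bounds on \<open>D\<close>; \<open>- A'\<close> is the lower bound for prefixes not
  followed by \<open>S\<close> and \<open>B'\<close> the upper bound for prefixes followed by \<open>L\<close>.  The constant
  is chosen slightly above the least feasible one for \<open>p = 2\<close>, which is about \<open>1.0337\<close>, and below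
  \<open>1.0379\<close>, where the length \<open>A + A / b\<close> would reach \<open>3/2\<close>.
\<close>

definition A :: real where "A = 207 / 200"
definition A' :: real where "A' = A - r"
definition B' :: real where "B' = A / b\<^sup>2 + e * A'"

text \<open>These are the numerators of the slacks in the three bounds below. After the shift
  \<open>b = 56 / 25 + t\<close> all coefficients in \<open>t\<close> are nonnegative.\<close>

lemma poly_bounds:
  defines "N \<equiv> A * (b + 1) - 1"
  shows "0 \<le> N * (b^4 - b^3 - (b - 1)\<^sup>2) - A * (b - 1) * (b + 1) - b\<^sup>2 * (b - 1)\<^sup>2 * (b + 1)"
    and "0 \<le> A * (b^3 - b\<^sup>2 - (b - 1)) * (b + 1) - b * (b - 1)\<^sup>2 * (b + 1)"
    and "0 \<le> N * (b^3 - b\<^sup>2) - A * (b - 1) * (b + 1)"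
proof -
  obtain t where t: "b = 56 / 25 + t" "t \<ge> 0" 
    using that[of "b - 56 / 25"] b_ge by simp
  show "0 \<le> N * (b^4 - b^3 - (b - 1)\<^sup>2) - A * (b - 1) * (b + 1) - b\<^sup>2 * (b - 1)\<^sup>2 * (b + 1)"
    "0 \<le> A * (b^3 - b\<^sup>2 - (b - 1)) * (b + 1) - b * (b - 1)\<^sup>2 * (b + 1)"
    "0 \<le> N * (b^3 - b\<^sup>2) - A * (b - 1) * (b + 1)"
    unfolding N_def A_def t(1) using t(2)
    by (simp_all add: eval_nat_numeral field_simps)
qed

lemma real_p_eq: "real p = b - (b - 1) / b\<^sup>2"
  using e_eq by (simp add: e_def)

lemma A'_eq: "A' = (A * (b + 1) - 1) / (b + 1)"
  using b_pos by (simp add: A'_def r_def field_simps)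

text \<open>Lower bound on \<open>D\<close> inside the image of \<open>L\<close>, with at most
  \<open>p - 1\<close> letters appended; the \<open>p\<close>-th one costs another \<open>r\<close>,
  which gives \<open>A\<close>.\<close>

lemma A'_bound: "A' / b + e * B' + r * (real p - 1) \<le> A'"
proof -
  define N where "N = A * (b + 1) - 1"
  have "A' - (A' / b + e * B' + r * (real p - 1)) =
    (N * (b^4 - b^3 - (b - 1)\<^sup>2) - A * (b - 1) * (b + 1) - b\<^sup>2 * (b - 1)\<^sup>2 * (b + 1)) / (b^4 * (b + 1))"
    unfolding B'_def A'_eq N_def[symmetric] e_eq r_def real_p_eq
    using b_pos by (simp add: divide_simps) (simp add: eval_nat_numeral algebra_simps)
  also have "\<dots> \<ge> 0"
    using poly_bounds(1) b_pos by (simp add: N_def)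
  finally show ?thesis by simp
qed

text \<open>Lower bound on \<open>D\<close> inside the image of \<open>M\<close>.\<close>

lemma A_bound: "A / b + e * (A / b) + r * (real p - 1) \<le> A"
proof -
  have "A - (A / b + e * (A / b) + r * (real p - 1)) =
    (A * (b^3 - b\<^sup>2 - (b - 1)) * (b + 1) - b * (b - 1)\<^sup>2 * (b + 1)) / (b^3 * (b + 1))"
    unfolding e_eq r_def real_p_eq
    using b_pos by (simp add: divide_simps) (simp add: eval_nat_numeral algebra_simps)
  also have "\<dots> \<ge> 0"
    using poly_bounds(2) b_pos by simp
  finally show ?thesis by simp
qed

text \<open>Lower bound on \<open>D\<close> for a prefix followed by \<open>M\<close>, that is, at
  the image of \<open>S\<close>.\<close>

lemma A'_bound_M: "A' / b + e * (A / b) \<le> A'"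
proof -
  define N where "N = A * (b + 1) - 1"
  have "A' - (A' / b + e * (A / b)) =
    (N * (b^3 - b\<^sup>2) - A * (b - 1) * (b + 1)) / (b^3 * (b + 1))"
    unfolding A'_eq N_def[symmetric] e_eq
    using b_pos by (simp add: divide_simps) (simp add: eval_nat_numeral algebra_simps)
  also have "\<dots> \<ge> 0"
    using poly_bounds(3) b_pos by (simp add: N_def)
  finally show ?thesis by simp
qed

text \<open>The upper bound \<open>A / b\<close> on \<open>D\<close> reproduces itself exactly,
  whatever the value of \<open>A\<close>.\<close>

lemma B_eq: "A / b / b + e * A = A / b"
  using b_pos by (simp add: e_eq field_simps power2_eq_square)

lemma B'_eq: "B' = A / b / b + e * A'"
  by (simp add: B'_def power2_eq_square)

text \<open>
  A prefix followed by \<open>M\<close> arises from one followed by \<open>S\<close>, every other prefix from one not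
  followed by \<open>S\<close>; hence the better bound on \<open>F\<close> in the latter case.
\<close>

definition bounded_state :: "letter list \<Rightarrow> letter \<Rightarrow> bool" where
  "bounded_state w x \<longleftrightarrow>
     - A \<le> D w \<and> D w \<le> A / b \<and> (x \<noteq> S \<longrightarrow> - A' \<le> D w) \<and> (x = L \<longrightarrow> D w \<le> B') \<and>
     - (A / b) \<le> F w \<and> F w \<le> A / b / b \<and> (x \<noteq> M \<longrightarrow> - (A' / b) \<le> F w)"

lemma bounded_state_step:
  assumes v: "bounded_state v y" and y: "phi p y = t @ x # s"
  shows "bounded_state (phi_word p v @ t) x"
proof -
  have A'_le: "A' \<le> A" using r_pos by (simp add: A'_def)
  have div: "- c \<le> D v \<Longrightarrow> - (c / b) \<le> D v / b" "D v \<le> c \<Longrightarrow> D v / b \<le> c / b" for c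
    using b_pos by (simp_all add: field_simps)
  have mult: "- c \<le> D v \<Longrightarrow> - (e * c) \<le> e * D v" "D v \<le> c \<Longrightarrow> e * D v \<le> e * c" for c
    using e_pos mult_left_mono[of "- c" "D v" e] by simp_all
  have eA: "e * A' \<le> e * A" using e_pos A'_le by simp
  have rd: "0 \<le> r * real d" for d using r_pos by simp
  have rdp: "r * real d \<le> r * (real p - 1)" if "d + 1 \<le> p" for d
    using r_pos that by (intro mult_left_mono) linarith+
  have r: "A = A' + r" "r * (real p - 1) = r * real p - r"
    by (simp_all add: A'_def algebra_simps)
  note v' = v[unfolded bounded_state_def]
  from y show ?thesis
  proof (cases rule: phi_split_cases)
    case (1 d)
    have "- (A' / b) \<le> F v" "- A' \<le> D v" "D v \<le> B'" "F v \<le> A / b / b" "D v \<le> A / b" "- A \<le> D v"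
      using v' 1 by auto
    note this mult(1)[OF this(2)] mult(2)[OF this(3)]
      div(1)[OF this(2)] div(1)[OF this(6)] div(2)[OF this(5)]
    then show ?thesis
      unfolding bounded_state_def 1 F_step D_step
      using A'_bound rd[of d] rdp[of d] 1 B'_eq B_eq eA r r_pos
      by (intro conjI impI) (simp; fail | linarith)+
  next
    case 2
    have "- (A' / b) \<le> F v" "- A' \<le> D v" "D v \<le> B'" "F v \<le> A / b / b" "D v \<le> A / b" "- A \<le> D v"
      using v' 2 by auto
    note this mult(1)[OF this(2)] mult(2)[OF this(3)]
      div(1)[OF this(2)] div(1)[OF this(6)] div(2)[OF this(5)]
    then show ?thesis
      unfolding bounded_state_def 2 F_step D_step
      using A'_bound rd[of p] B'_eq B_eq eA r r_pos
      by (intro conjI impI) (simp; fail | linarith)+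
  next
    case 3
    have t: "t = replicate 0 L" using 3 by simp
    have "- (A' / b) \<le> F v" "- A \<le> D v" "D v \<le> A / b" "F v \<le> A / b / b"
      using v' 3 by auto
    note this mult(1)[OF this(2)] mult(2)[OF this(3)]
      div(1)[OF this(2)] div(2)[OF this(3)]
    then show ?thesis
      unfolding bounded_state_def t 3(2) F_step D_step
      using A'_bound_M B_eq eA r r_pos
      by (intro conjI impI) (simp; fail | linarith)+
  next
    case (4 d)
    have "- (A / b) \<le> F v" "- A' \<le> D v" "D v \<le> A / b" "F v \<le> A / b / b" "- A \<le> D v"
      using v' 4 by auto
    note this mult(1)[OF this(2)] mult(2)[OF this(3)]
      div(1)[OF this(2)] div(1)[OF this(5)] div(2)[OF this(3)]
    \<comment> \<open>Before an \<open>L\<close> at least one letter \<open>L\<close> of the block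
      is still missing; the saved \<open>r\<close> improves \<open>A\<close> to
      \<open>A'\<close>.\<close>
    moreover have "r * real d + r \<le> r * (real p - 1)"
      using rdp[of "d + 1"] 4 by (simp add: algebra_simps)
    ultimately show ?thesis
      unfolding bounded_state_def 4 F_step D_step
      using A_bound rd[of d] 4 B'_eq B_eq eA r r_pos
      by (intro conjI impI) (simp; fail | linarith)+
  next
    case 5
    have "- (A / b) \<le> F v" "- A' \<le> D v" "D v \<le> A / b" "F v \<le> A / b / b" "- A \<le> D v"
      using v' 5 by auto
    note this mult(1)[OF this(2)] mult(2)[OF this(3)]
      div(1)[OF this(2)] div(1)[OF this(5)] div(2)[OF this(3)]
    moreover have "r * real (p - 1) = r * (real p - 1)"
      using p_gt_1 by (simp add: of_nat_diff)
    ultimately show ?thesis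
      unfolding bounded_state_def 5 F_step D_step
      using A_bound rd[of "p - 1"] B'_eq B_eq eA r r_pos
      by (intro conjI impI) (simp; fail | linarith)+
  qed
qed

lemma D_prefix_bounds: "- A \<le> D (map (u p) [0..<n])" "D (map (u p) [0..<n]) \<le> A / b"
proof -
  have "r \<le> 1" using b_pos by (simp add: r_def)
  then have "0 \<le> A'" "0 \<le> A" by (simp_all add: A'_def A_def)
  moreover from this have "0 \<le> B'" using e_pos by (simp add: B'_def)
  ultimately have "bounded_state [] L" using b_pos by (simp add: bounded_state_def)
  then have "bounded_state (map (u p) [0..<n]) (u p n)"
    using p_gt_1 bounded_state_step by (intro u_prefix_induct[where P = bounded_state]) simp_all
  then show "- A \<le> D (map (u p) [0..<n])" "D (map (u p) [0..<n]) \<le> A / b"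
    by (simp_all add: bounded_state_def)
qed

text \<open>A factor is the difference of two prefixes, so its discrepancy is at most the length
  \<open>A + A / b\<close> of the interval containing theirs.\<close>

lemma D_factor_bounds:
  assumes "factor v (u p)"
  shows "\<bar>D v\<bar> < 3 / 2"
proof -
  obtain i where i: "v = map (u p) [i..<i + length v]"
    using assms by (auto simp: factor_def)
  have "map (u p) [0..<i + length v] = map (u p) [0..<i] @ v"
    using i by (metis le0 map_append upt_add_eq_append)
  then have "D v = D (map (u p) [0..<i + length v]) - D (map (u p) [0..<i])"
    by (simp add: D_append)
  moreover have "A + A / b < 3 / 2"
    using b_ge by (simp add: A_def field_simps)
  ultimately show ?thesis
    using D_prefix_bounds[of i] D_prefix_bounds[of "i + length v"] by linarith
qed

end

lemma dominant_root_exists: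
  assumes "p > 1"
  obtains b where "dominant_root p b"
proof -
  define g where "g x = x\<^sup>2 * (x - real p) - x + 1" for x
  \<comment> \<open>At \<open>x = p\<close> the cubic equals \<open>1 - p\<close>, so
    \<open>p\<close> is a valid left endpoint; for \<open>p = 2\<close> it is too small for the
    locale, and 56/25 still gives a negative value.\<close>
  define l where "l = (if p = 2 then 56 / 25 else real p)"
  have "g l \<le> 0"
    using assms by (auto simp: g_def l_def power2_eq_square)
  moreover have "0 \<le> g (real p + 1)"
    by (simp add: g_def power2_eq_square algebra_simps)
  moreover have "l \<le> real p + 1" by (simp add: l_def)
  moreover have "continuous_on {l..real p + 1} g"
    unfolding g_def by (intro continuous_intros)
  ultimately obtain b where b: "l \<le> b" "g b = 0"
    using IVT'[of g l 0 "real p + 1"] by auto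
  have "56 / 25 \<le> l" using assms by (auto simp: l_def)
  then have "dominant_root p b"
    using assms b by unfold_locales (auto simp: g_def)
  then show ?thesis using that by blast
qed

theorem theorem5p1:
  fixes p :: nat and v w :: "letter list"
  assumes "p > 1"
    and "factor v (u p)" and "factor w (u p)"
    and "length v = length w"
  shows "\<bar>int (count_list v S) - int (count_list w S)\<bar> \<le> 2"
proof -
  obtain b where "dominant_root p b" using dominant_root_exists assms(1) by blast
  then interpret dominant_root p b .
  have "\<bar>D v - D w\<bar> < 3"
    using D_factor_bounds[OF assms(2)] D_factor_bounds[OF assms(3)] by linarith
  \<comment> \<open>Equal lengths cancel the terms with \<open>r\<close>.\<close>
  then have "\<bar>real_of_int (int (count_list v S) - int (count_list w S))\<bar> < 3"
    using assms(4) by (simp add: D_def)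
  then show ?thesis by linarith
qed

end
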